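(* Let $\varphi$ be a Ma-Minda function with $\varphi(z)=1+B_1z+B_2z^2+B_3z^3+\cdots$, and let $f\in\mathcal{S}^*(\varphi)$. If $|B_2-2B_1^2|\ge B_1$, then $$|T_{2,1}(F_{f^{-1}})|=|\Gamma_1^2-\Gamma_2^2|\le \frac{B_1^2}{4}+\frac{1}{16}(2B_1^2-B_2)^2 .$$ The inequality is sharp (for each such $\varphi$, equality is attained by some $f\in\mathcal{S}^*(\varphi)$).
   Context: $\mathbb{U}=\{z\in\mathbb{C}:|z|<1\}$, and $\mathcal{A}$ is the class of analytic functions $f$ on $\mathbb{U}$ of the form $f(z)=z+\sum_{n\ge2}a_nz^n$. For analytic $g,h$ on $\mathbb{U}$, $g\prec h$ (subordination) means there is an analytic $\omega:\mathbb{U}\to\mathbb{C}$ with $\omega(0)=0$, $|\omega(z)|\le1$, and $g=h\circ\omega$. A Ma-Minda function is an analytic univalent $\varphi$ on $\mathbb{U}$ with $\varphi(0)=1$, $\varphi'(0)>0$, mapping $\mathbb{U}$ onto a domain in the right half-plane that is symmetric about the real axis and starlike with respect to $\varphi(0)=1$ (so $B_1>0$ and all $B_n$ are real). $\mathcal{S}^*(\varphi)=\{f\in\mathcal{A}: zf'(z)/f(z)\prec\varphi(z)\}$; its members are univalent. The local inverse $f^{-1}$ near $0$ has the logarithmic coefficients $\Gamma_n$ defined by $F_{f^{-1}}(w)=\log\big(f^{-1}(w)/w\big)=2\sum_{n\ge1}\Gamma_nw^n$ (with $\log 1=0$). Equivalently $\Gamma_1=-\tfrac{a_2}{2}$, $\Gamma_2=-\tfrac12(a_3-\tfrac32a_2^2)$.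 Definition: $T_{2,1}(F_{f^{-1}})=\Gamma_1^2-\Gamma_2^2$. *)

theory Defs
  imports "HOL-Complex_Analysis.Complex_Analysis"
begin

abbreviation unit_disc :: "complex set" (\<open>\<U>\<close>) where
  "\<U> \<equiv> ball 0 1"

definition class_A :: "(complex \<Rightarrow> complex) set" where
  "class_A = {f. f holomorphic_on \<U> \<and> f 0 = 0 \<and> deriv f 0 = 1}"

definition subordinate :: "(complex \<Rightarrow> complex) \<Rightarrow> (complex \<Rightarrow> complex) \<Rightarrow> bool"
    (infix \<open>\<prec>\<^sub>s\<close> 50) where
  "g \<prec>\<^sub>s h \<longleftrightarrow>
     (\<exists>\<omega>. \<omega> holomorphic_on \<U> \<and> \<omega> 0 = 0 \<and> (\<forall>z\<in>\<U>. cmod (\<omega> z) \<le> 1) \<and>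
          (\<forall>z\<in>\<U>. g z = h (\<omega> z)))"

definition ma_minda :: "(complex \<Rightarrow> complex) \<Rightarrow> bool" where
  "ma_minda \<phi> \<longleftrightarrow>
     \<phi> holomorphic_on \<U> \<and> inj_on \<phi> \<U> \<and>
     \<phi> 0 = 1 \<and> deriv \<phi> 0 \<in> \<real> \<and> Re (deriv \<phi> 0) > 0 \<and>
     \<phi> ` \<U> \<subseteq> {w. Re w > 0} \<and>
     cnj ` (\<phi> ` \<U>) = \<phi> ` \<U> \<and>
     (\<forall>w\<in>\<phi> ` \<U>. closed_segment (\<phi> 0) w \<subseteq> \<phi> ` \<U>)"

text \<open>
  The Taylor coefficients of a Ma-Minda function at 0 are real (a consequence of the symmetry of
  its image, proved below as \<open>ma_minda_coeff_real\<close>), so nothing is lost by the real part.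
\<close>

definition ma_minda_coeff :: "(complex \<Rightarrow> complex) \<Rightarrow> nat \<Rightarrow> real" where
  "ma_minda_coeff \<phi> n = Re (fps_nth (fps_expansion \<phi> 0) n)"

text \<open>
  The quotient \<open>z f'(z) / f(z)\<close> has a removable singularity at 0, where its value is 1. For it to be
  defined elsewhere, \<open>f\<close> must not vanish on the punctured disc.
\<close>

definition starlike_class :: "(complex \<Rightarrow> complex) \<Rightarrow> (complex \<Rightarrow> complex) set" where
  "starlike_class \<phi> =
     {f \<in> class_A. (\<forall>z\<in>\<U> - {0}. f z \<noteq> 0) \<and>
        (\<lambda>z. if z = 0 then 1 else z * deriv f z / f z) \<prec>\<^sub>s \<phi>}"

definition is_local_inverse :: "(complex \<Rightarrow> complex) \<Rightarrow> (complex \<Rightarrow> complex) \<Rightarrow> bool" where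
  "is_local_inverse f g \<longleftrightarrow>
     (\<exists>r>0. g holomorphic_on ball 0 r \<and> g 0 = 0 \<and> (\<forall>w\<in>ball 0 r. g w \<in> \<U> \<and> f (g w) = w))"

text \<open>
  A local inverse of \<open>f \<in> class_A\<close> exists and its germ at 0 is unique (\<open>local_inverse_exists\<close> and
  \<open>local_inverse_unique\<close> below); only the germ matters for what follows.
\<close>

definition local_inverse :: "(complex \<Rightarrow> complex) \<Rightarrow> complex \<Rightarrow> complex" where
  "local_inverse f = (SOME g. is_local_inverse f g)"

definition inv_log :: "(complex \<Rightarrow> complex) \<Rightarrow> complex \<Rightarrow> complex" where
  "inv_log f w = (if w = 0 then 0 else Ln (local_inverse f w / w))"

definition inv_log_coeff :: "(complex \<Rightarrow> complex) \<Rightarrow> nat \<Rightarrow> complex" where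
  "inv_log_coeff f n = fps_nth (fps_expansion (inv_log f) 0) n / 2"

definition T21_inv_log :: "(complex \<Rightarrow> complex) \<Rightarrow> complex" where
  "T21_inv_log f = (inv_log_coeff f 1)\<^sup>2 - (inv_log_coeff f 2)\<^sup>2"

lemma ma_minda_cnj:
  assumes "ma_minda \<phi>" and "z \<in> \<U>"
  shows "cnj (\<phi> (cnj z)) = \<phi> z"
proof -
  have hol: "\<phi> holomorphic_on \<U>" and inj: "inj_on \<phi> \<U>" and \<phi>0: "\<phi> 0 = 1"
    and real: "deriv \<phi> 0 \<in> \<real>" and sym: "cnj ` (\<phi> ` \<U>) = \<phi> ` \<U>"
    using assms(1) by (auto simp: ma_minda_def)
  obtain g where g: "g holomorphic_on \<phi> ` \<U>"
    and dg: "\<And>z. z \<in> \<U> \<Longrightarrow> deriv \<phi> z * deriv g (\<phi> z) = 1"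
    and gi: "\<And>z. z \<in> \<U> \<Longrightarrow> g (\<phi> z) = z"
    using holomorphic_has_inverse[OF hol _ inj] by blast
  have op: "open (\<phi> ` \<U>)" using open_mapping_thm3[OF hol _ inj] by simp
  have mem: "\<exists>y\<in>\<U>. cnj (\<phi> (cnj z)) = \<phi> y" if "z \<in> \<U>" for z
  proof -
    have "cnj z \<in> \<U>" using that by simp
    then have "cnj (\<phi> (cnj z)) \<in> cnj ` (\<phi> ` \<U>)" by blast
    then show ?thesis unfolding sym by blast
  qed
  define \<psi> where "\<psi> = cnj \<circ> \<phi> \<circ> cnj"
  have "cnj ` \<U> = \<U>" by (auto simp: image_iff intro!: exI[of _ "cnj _"] bexI[of _ "cnj _"])
  then have hol\<psi>: "\<psi> holomorphic_on \<U>"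
    unfolding \<psi>_def using holomorphic_on_compose_cnj_cnj[of \<phi> \<U>] hol by simp
  define h where "h = g \<circ> \<psi>"
  have im: "\<psi> ` \<U> \<subseteq> \<phi> ` \<U>" using mem by (fastforce simp: \<psi>_def)
  have holh: "h holomorphic_on \<U>"
    unfolding h_def by (rule holomorphic_on_compose_gen[OF hol\<psi> g im])
  have h0: "h 0 = 0" using gi[of 0] \<phi>0 by (simp add: h_def \<psi>_def)
  have hb: "norm (h z) < 1" if "norm z < 1" for z
    using mem[of z] that gi by (auto simp: h_def \<psi>_def)
  have "(\<phi> has_field_derivative deriv \<phi> 0) (at 0)"
    using hol by (intro holomorphic_derivI[of _ \<U>]) auto
  then have "(\<psi> has_field_derivative cnj (deriv \<phi> 0)) (at 0)"
    unfolding \<psi>_def using has_field_derivative_cnj_cnj[of \<phi> "deriv \<phi> 0" 0] by simp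
  moreover have "cnj (deriv \<phi> 0) = deriv \<phi> 0" using real by (simp add: Reals_cnj_iff)
  moreover have "(g has_field_derivative deriv g (\<psi> 0)) (at (\<psi> 0))"
    using g op \<phi>0 by (intro holomorphic_derivI[of _ "\<phi> ` \<U>"]) (auto simp: \<psi>_def intro!: image_eqI[of _ _ 0])
  ultimately have "(h has_field_derivative deriv g (\<psi> 0) * deriv \<phi> 0) (at 0)"
    unfolding h_def by (metis DERIV_chain)
  moreover have "deriv g (\<psi> 0) * deriv \<phi> 0 = 1"
    using dg[of 0] \<phi>0 by (simp add: \<psi>_def mult.commute)
  ultimately have dh: "deriv h 0 = 1" by (simp add: DERIV_imp_deriv)
  obtain \<alpha> where \<alpha>: "\<And>z. norm z < 1 \<Longrightarrow> h z = \<alpha> * z"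
    using Schwarz_Lemma(3)[OF holh h0 hb, of 0] dh by auto
  have "deriv h 0 = deriv (\<lambda>z. \<alpha> * z) 0"
    by (rule deriv_cong_ev) (auto intro!: eventually_nhds_in_open[of \<U>] eventually_mono[OF eventually_nhds_in_open[of \<U> 0]] \<alpha>)
  then have "\<alpha> = 1" using dh by simp
  then have "h z = z" using \<alpha> assms(2) by simp
  moreover obtain y where "y \<in> \<U>" "cnj (\<phi> (cnj z)) = \<phi> y" using mem assms(2) by blast
  ultimately show ?thesis using gi by (simp add: h_def \<psi>_def)
qed

lemma ma_minda_coeff_real:
  assumes "ma_minda \<phi>"
  shows "fps_nth (fps_expansion \<phi> 0) n = complex_of_real (ma_minda_coeff \<phi> n)"
proof -
  have hol: "\<phi> holomorphic_on \<U>" using assms by (simp add: ma_minda_def)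
  have *: "(deriv ^^ n) \<phi> (cnj z) = cnj ((deriv ^^ n) \<phi> z)" if "z \<in> \<U>" for z
    using that
  proof (induction n arbitrary: z)
    case 0
    then show ?case using ma_minda_cnj[OF assms, of z] by (metis complex_cnj_cnj funpow_0)
  next
    case (Suc n)
    let ?F = "(deriv ^^ n) \<phi>"
    have "?F holomorphic_on \<U>" using hol by (simp add: holomorphic_higher_deriv)
    then have "(?F has_field_derivative deriv ?F z) (at z)"
      using Suc.prems by (intro holomorphic_derivI[of _ \<U>]) auto
    then have "((cnj \<circ> ?F \<circ> cnj) has_field_derivative cnj (deriv ?F z)) (at (cnj z))"
      using has_field_derivative_cnj_cnj[of ?F "deriv ?F z" "cnj z"] by simp
    then have "deriv (cnj \<circ> ?F \<circ> cnj) (cnj z) = cnj (deriv ?F z)" by (rule DERIV_imp_deriv)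
    moreover have "deriv (cnj \<circ> ?F \<circ> cnj) (cnj z) = deriv ?F (cnj z)"
      by (rule deriv_cong_ev[OF eventually_mono[OF eventually_nhds_in_open[of \<U>]]])
         (use Suc in auto)
    ultimately show ?case by simp
  qed
  have "cnj (fps_nth (fps_expansion \<phi> 0) n) = fps_nth (fps_expansion \<phi> 0) n"
    using *[of 0] by (simp add: fps_expansion_def)
  then show ?thesis
    by (simp add: ma_minda_coeff_def complex_eq_iff)
qed

lemma local_inverse_exists:
  assumes "f \<in> class_A"
  shows "is_local_inverse f (local_inverse f)"
proof -
  have hol: "f holomorphic_on \<U>" and f0: "f 0 = 0" and f1: "deriv f 0 \<noteq> 0"
    using assms by (auto simp: class_A_def)
  obtain s where s: "s > 0" "ball 0 s \<subseteq> \<U>" "open (f ` ball 0 s)" "inj_on f (ball 0 s)"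
    using has_complex_derivative_locally_invertible[OF hol _ _ f1] by auto
  obtain g where g: "g holomorphic_on f ` ball 0 s" "\<And>z. z \<in> ball 0 s \<Longrightarrow> g (f z) = z"
    using holomorphic_has_inverse[OF holomorphic_on_subset[OF hol s(2)] _ s(4)] by blast
  have "0 \<in> f ` ball 0 s" using s(1) f0 by (auto intro!: image_eqI[of _ _ 0])
  then obtain r where r: "r > 0" "ball 0 r \<subseteq> f ` ball 0 s"
    using s(3) open_contains_ball by blast
  have "\<forall>w\<in>ball 0 r. g w \<in> \<U> \<and> f (g w) = w"
  proof
    fix w assume "w \<in> ball (0::complex) r"
    then obtain z where "z \<in> ball 0 s" "w = f z" using r(2) by blast
    then show "g w \<in> \<U> \<and> f (g w) = w" using g(2) s(2) by auto
  qed
  moreover have "g 0 = 0" using g(2)[of 0] s(1) f0 by simp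
  ultimately have "is_local_inverse f g"
    unfolding is_local_inverse_def using r g(1) holomorphic_on_subset by blast
  then show ?thesis unfolding local_inverse_def by (rule someI[of "is_local_inverse f"])
qed

lemma local_inverse_unique:
  assumes "f \<in> class_A" "is_local_inverse f g" "is_local_inverse f h"
  shows "\<forall>\<^sub>F w in nhds 0. g w = h w"
proof -
  have hol: "f holomorphic_on \<U>" and f1: "deriv f 0 \<noteq> 0"
    using assms by (auto simp: class_A_def)
  obtain s where s: "s > 0" "inj_on f (ball 0 s)"
    using has_complex_derivative_locally_invertible[OF hol _ _ f1] by auto
  have *: "\<forall>\<^sub>F w in nhds 0. k w \<in> ball 0 s \<and> f (k w) = w" if "is_local_inverse f k" for k
  proof -
    obtain r where r: "r > 0" "k holomorphic_on ball 0 r" "k 0 = 0" "\<forall>w\<in>ball 0 r. f (k w) = w"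
      using \<open>is_local_inverse f k\<close> unfolding is_local_inverse_def by blast
    have "continuous_on (ball 0 r) k" using r(2) holomorphic_on_imp_continuous_on by blast
    then have "isCont k 0" using r(1) by (simp add: continuous_on_eq_continuous_at)
    then have "filterlim k (nhds 0) (nhds 0)"
      using r(3) by (simp add: isCont_def tendsto_nhds_iff)
    then have "\<forall>\<^sub>F w in nhds 0. k w \<in> ball 0 s"
      unfolding filterlim_iff
      using eventually_nhds_in_open[of "ball 0 s" "0::complex"] s(1) by force
    moreover have "\<forall>\<^sub>F w in nhds 0. w \<in> ball (0::complex) r"
      using r(1) by (intro eventually_nhds_in_open) auto
    ultimately show ?thesis by eventually_elim (use r(4) in auto)
  qed
  from *[OF assms(2)] *[OF assms(3)] show ?thesis
    by eventually_elim (metis s(2) inj_onD)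
qed

end

theory Submission
  imports Defs
begin

text \<open>
  Write \<open>z f'(z) / f(z) = \<phi>(\<omega>(z))\<close> with \<open>\<omega>(z) = w\<^sub>1 z + w\<^sub>2 z^2 + \<dots>\<close>. Comparing coefficients gives
  \<open>\<Gamma>\<^sub>1 = - B\<^sub>1 w\<^sub>1 / 2\<close> and \<open>\<Gamma>\<^sub>2 = - (B\<^sub>1 w\<^sub>2 + (B\<^sub>2 - 2 B\<^sub>1^2) w\<^sub>1^2) / 4\<close>. The Schwarz-Pick inequality
  at 0 for \<open>\<omega>(z) / z\<close> yields \<open>\<bar>w\<^sub>2\<bar> \<le> 1 - \<bar>w\<^sub>1\<bar>^2\<close>, so the hypothesis makes \<open>\<bar>\<Gamma>\<^sub>2\<bar>\<close> largest when
  \<open>\<bar>w\<^sub>1\<bar> = 1\<close>. For \<open>\<omega>(z) = \<i> z\<close> the numbers \<open>\<Gamma>\<^sub>1^2\<close> and \<open>- \<Gamma>\<^sub>2^2\<close> are both nonpositive reals, which gives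
  equality.
\<close>

section \<open>Schwarz-Pick estimates at the origin\<close>

lemma norm_deriv_unit_disc_map_le:
  assumes hol: "g holomorphic_on \<U>" and le: "\<And>z. z \<in> \<U> \<Longrightarrow> cmod (g z) \<le> 1"
  shows "cmod (deriv g 0) \<le> 1 - (cmod (g 0))\<^sup>2"
proof (cases "\<exists>z\<in>\<U>. cmod (g z) = 1")
  case True
  then obtain \<xi> where \<xi>: "\<xi> \<in> \<U>" "cmod (g \<xi>) = 1" by blast
  have "g constant_on \<U>"
    by (rule maximum_modulus_principle[OF hol _ _ _ order.refl \<xi>(1)]) (use le \<xi> in auto)
  then obtain c where c: "\<And>z. z \<in> \<U> \<Longrightarrow> g z = c"
    by (auto simp: constant_on_def)
  have "deriv g 0 = deriv (\<lambda>_. c) 0"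
    by (rule deriv_cong_ev[OF eventually_mono[OF eventually_nhds_in_open[of \<U>]]]) (use c in auto)
  moreover have "cmod (g 0) = 1" using c \<xi> by simp
  ultimately show ?thesis by simp
next
  case False
  then have lt: "cmod (g z) < 1" if "z \<in> \<U>" for z
    using le that by (metis order_le_less)
  define a where "a = g 0"
  have a: "cmod a < 1" using lt[of 0] by (simp add: a_def)
  define h where "h = Moebius_function 0 a \<circ> g"
  have holh: "h holomorphic_on \<U>"
    unfolding h_def using lt
    by (intro holomorphic_on_compose_gen[OF hol Moebius_function_holomorphic[OF a]]) auto
  have h0: "h 0 = 0" by (simp add: h_def a_def Moebius_function_eq_zero)
  have "cmod (h z) < 1" if "cmod z < 1" for z
    unfolding h_def o_def using Moebius_function_norm_lt_1[OF a] lt that by simp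
  then have dh: "cmod (deriv h 0) \<le> 1"
    using Schwarz_Lemma(2)[OF holh h0, of 0] by simp
  have pos: "0 < 1 - (cmod a)\<^sup>2" using a by (simp add: power_less_one_iff abs_square_less_1)
  have real: "1 - cnj a * a = complex_of_real (1 - (cmod a)\<^sup>2)"
    by (simp add: mult.commute[of "cnj a"] complex_norm_square[symmetric] flip: of_real_power)
  then have nz: "1 - cnj a * a \<noteq> 0" using pos by (metis less_irrefl of_real_eq_0_iff)
  have "(g has_field_derivative deriv g 0) (at 0)"
    using hol by (intro holomorphic_derivI[of _ \<U>]) auto
  then have "(h has_field_derivative deriv g 0 / (1 - cnj a * a)) (at 0)"
    unfolding h_def o_def Moebius_function_simple
    using nz by (auto intro!: derivative_eq_intros simp: a_def divide_simps)
  then have "deriv h 0 = deriv g 0 / (1 - cnj a * a)" by (rule DERIV_imp_deriv)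
  then have "cmod (deriv h 0) = cmod (deriv g 0) / (1 - (cmod a)\<^sup>2)"
    using pos by (simp add: real norm_divide del: of_real_diff)
  then show ?thesis using dh pos by (simp add: a_def field_simps)
qed

section \<open>Power series at the origin\<close>

lemma holomorphic_has_fps_expansion:
  assumes "f holomorphic_on \<U>"
  shows "f has_fps_expansion fps_expansion f 0"
  using assms by (intro analytic_at_imp_has_fps_expansion_0) (auto simp: analytic_at intro!: exI[of _ \<U>])

lemma has_fps_expansion_deriv_0:
  fixes f :: "complex \<Rightarrow> complex"
  assumes "f has_fps_expansion F"
  shows "deriv f 0 = fps_nth F 1"
  using fps_nth_fps_expansion[OF assms, of 1] by simp

text \<open>Turns a functional equation valid near 0 into an identity of formal power series; every
  comparison of coefficients below rests on it.\<close>

lemma fps_expansion_unique_eventually: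
  fixes f g :: "complex \<Rightarrow> complex"
  assumes "f has_fps_expansion F" "g has_fps_expansion G" "\<forall>\<^sub>F z in nhds 0. f z = g z"
  shows "F = G"
  using has_fps_expansion_cong[OF assms(3) refl, of F] assms(1,2) fps_expansion_unique_complex by blast

text \<open>For \<open>g(z) = \<omega>(z) / z\<close> the coefficients of \<omega> shift down by
  one: \<open>w\<^sub>1 = g(0)\<close> and \<open>w\<^sub>2 = g'(0)\<close>. The Schwarz lemma makes
  \<open>g\<close> bounded by 1, so the derivative bound above applies to it.\<close>

lemma Schwarz_function_coeffs:
  assumes hol: "\<omega> holomorphic_on \<U>" and zero: "\<omega> 0 = 0"
    and le: "\<And>z. z \<in> \<U> \<Longrightarrow> cmod (\<omega> z) \<le> 1"
    and W: "\<omega> has_fps_expansion W"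
  shows "cmod (fps_nth W 2) \<le> 1 - (cmod (fps_nth W 1))\<^sup>2"
proof -
  \<comment> \<open>The Schwarz lemma asks for a strict bound. Equality at an interior point would
    make \<omega> constant, contradicting \<open>\<omega> 0 = 0\<close>.\<close>
  have lt: "cmod (\<omega> z) < 1" if "cmod z < 1" for z
  proof (rule ccontr)
    assume "\<not> ?thesis"
    then have z: "z \<in> \<U>" "cmod (\<omega> z) = 1" using le[of z] that by auto
    have "\<omega> constant_on \<U>"
      by (rule maximum_modulus_principle[OF hol _ _ _ order.refl z(1)]) (use le z in auto)
    then have "\<omega> z = \<omega> 0" using z(1) unfolding constant_on_def by (metis centre_in_ball zero_less_one)
    then show False using z(2) zero by simp
  qed
  obtain g where g: "g holomorphic_on \<U>" "\<And>z. cmod z < 1 \<Longrightarrow> \<omega> z = z * g z" "deriv \<omega> 0 = g 0"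
    using Schwarz3[OF hol zero] by blast
  have gle: "cmod (g z) \<le> 1" if "z \<in> \<U>" for z
  proof (cases "z = 0")
    case True
    then show ?thesis using Schwarz_Lemma(2)[OF hol zero lt, of 0] g(3) by simp
  next
    case False
    have "cmod z * cmod (g z) \<le> cmod z"
      using Schwarz_Lemma(1)[OF hol zero lt, of z] g(2)[of z] that by (simp add: norm_mult)
    then show ?thesis using False by simp
  qed
  define G where "G = fps_expansion g 0"
  have G: "g has_fps_expansion G" unfolding G_def using g(1) by (rule holomorphic_has_fps_expansion)
  have "(\<lambda>z. z * g z) has_fps_expansion fps_X * G"
    by (intro fps_expansion_intros G)
  moreover have "\<forall>\<^sub>F z in nhds 0. \<omega> z = z * g z"
    using g(2) by (intro eventually_mono[OF eventually_nhds_in_open[of \<U>]]) auto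
  ultimately have "W = fps_X * G" by (rule fps_expansion_unique_eventually[OF W])
  then show ?thesis
    using norm_deriv_unit_disc_map_le[OF g(1) gle] has_fps_expansion_deriv_0[OF G]
      has_fps_expansion_imp_0_eq_fps_nth_0[OF G] by (simp add: numeral_2_eq_2)
qed

section \<open>Low-order coefficients of products and compositions\<close>

lemma fps_mult_nth_2:
  fixes A B :: "'a::comm_ring_1 fps"
  shows "fps_nth (A * B) 2 = fps_nth A 0 * fps_nth B 2 + fps_nth A 1 * fps_nth B 1 + fps_nth A 2 * fps_nth B 0"
  by (simp add: fps_mult_nth numeral_2_eq_2)

lemma fps_mult_nth_3:
  fixes A B :: "'a::comm_ring_1 fps"
  shows "fps_nth (A * B) 3 = fps_nth A 0 * fps_nth B 3 + fps_nth A 1 * fps_nth B 2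
    + fps_nth A 2 * fps_nth B 1 + fps_nth A 3 * fps_nth B 0"
  by (simp add: fps_mult_nth numeral_2_eq_2 numeral_3_eq_3)

lemma fps_compose_nth_low:
  fixes A B :: "'a::comm_ring_1 fps"
  assumes "fps_nth B 0 = 0"
  shows "fps_nth (A oo B) 1 = fps_nth A 1 * fps_nth B 1"
    and "fps_nth (A oo B) 2 = fps_nth A 1 * fps_nth B 2 + fps_nth A 2 * (fps_nth B 1)\<^sup>2"
    and "fps_nth (A oo B) 3 = fps_nth A 1 * fps_nth B 3
      + 2 * fps_nth A 2 * fps_nth B 1 * fps_nth B 2 + fps_nth A 3 * (fps_nth B 1) ^ 3"
  using assms
  by (simp_all add: fps_compose_nth numeral_2_eq_2 numeral_3_eq_3 fps_mult_nth algebra_simps)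

section \<open>The local inverse and its logarithm\<close>

text \<open>The equation \<open>f (g w) = w\<close> reads \<open>F oo G = fps_X\<close>. As
  \<open>F\<close> has linear coefficient 1, its coefficient of order n is linear in the n-th
  coefficient of \<open>G\<close> with factor 1, so orders 1, 2, 3 are solved in turn.\<close>

lemma local_inverse_coeffs:
  assumes A: "f \<in> class_A" and F: "f has_fps_expansion F"
  obtains G where "local_inverse f has_fps_expansion G" "fps_nth G 0 = 0" "fps_nth G 1 = 1"
    "fps_nth G 2 = - fps_nth F 2" "fps_nth G 3 = 2 * (fps_nth F 2)\<^sup>2 - fps_nth F 3"
proof -
  define g where "g = local_inverse f"
  obtain r where r: "r > 0" "g holomorphic_on ball 0 r" "g 0 = 0" "\<And>w. w \<in> ball 0 r \<Longrightarrow> f (g w) = w"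
    using local_inverse_exists[OF A] unfolding is_local_inverse_def g_def by blast
  define G where "G = fps_expansion g 0"
  have G: "g has_fps_expansion G"
    unfolding G_def using r(1,2)
    by (intro analytic_at_imp_has_fps_expansion_0) (auto simp: analytic_at intro!: exI[of _ "ball 0 r"])
  have G0: "fps_nth G 0 = 0" using has_fps_expansion_imp_0_eq_fps_nth_0[OF G] r(3) by simp
  have F1: "fps_nth F 1 = 1"
    using A has_fps_expansion_deriv_0[OF F] by (simp add: class_A_def)
  have "(f \<circ> g) has_fps_expansion (F oo G)" by (rule has_fps_expansion_compose[OF F G G0])
  moreover have "\<forall>\<^sub>F w in nhds 0. (f \<circ> g) w = w"
    using r by (intro eventually_mono[OF eventually_nhds_in_open[of "ball 0 r"]]) auto
  ultimately have eq: "F oo G = fps_X"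
    by (rule fps_expansion_unique_eventually[OF _ has_fps_expansion_fps_X])
  have G1: "fps_nth G 1 = 1"
    using arg_cong[OF eq, of "\<lambda>H. fps_nth H 1"] F1 by (simp only: fps_compose_nth_low[OF G0]) simp
  have G2: "fps_nth G 2 = - fps_nth F 2"
    using arg_cong[OF eq, of "\<lambda>H. fps_nth H 2"] F1 G1
    by (simp only: fps_compose_nth_low[OF G0]) (simp add: eq_neg_iff_add_eq_0)
  have "fps_nth G 3 = 2 * (fps_nth F 2)\<^sup>2 - fps_nth F 3"
    using arg_cong[OF eq, of "\<lambda>H. fps_nth H 3"] F1 G1 G2
    by (simp only: fps_compose_nth_low[OF G0]) (simp add: algebra_simps power2_eq_square)
  with G G0 G1 G2 show ?thesis using that unfolding g_def by blast
qed

text \<open>Instead of expanding the logarithm, exponentiate: with \<open>L\<close> the series of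
  \<open>inv_log f\<close>, comparing \<open>exp \<circ> inv_log f\<close> with
  \<open>g(w) / w\<close> at orders 1 and 2 gives \<open>L\<close> in terms of the inverse
  coefficients.\<close>

lemma inv_log_coeffs:
  assumes A: "f \<in> class_A" and F: "f has_fps_expansion F"
  shows "inv_log_coeff f 1 = - fps_nth F 2 / 2"
    and "inv_log_coeff f 2 = - (fps_nth F 3 - 3 / 2 * (fps_nth F 2)\<^sup>2) / 2"
proof -
  obtain G where G: "local_inverse f has_fps_expansion G" "fps_nth G 0 = 0" "fps_nth G 1 = 1"
    "fps_nth G 2 = - fps_nth F 2" "fps_nth G 3 = 2 * (fps_nth F 2)\<^sup>2 - fps_nth F 3"
    using local_inverse_coeffs[OF A F] .
  \<comment> \<open>The value 1 fills the removable singularity. It lies off the branch cut of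
    \<open>Ln\<close>, so \<open>Ln \<circ> q\<close> is analytic at 0, and \<open>Ln 1 = 0\<close>
    matches the value of \<open>inv_log f\<close> there.\<close>
  define q where "q w = (if w = 0 then 1 else local_inverse f w / w)" for w
  have "subdegree G \<ge> 1" using G(2,3) by (intro subdegree_geI) auto
  then have "(\<lambda>w. if w = 0 then 1 else local_inverse f w / w ^ 1) has_fps_expansion fps_shift 1 G"
    using G by (intro has_fps_expansion_shift) auto
  then have Q: "q has_fps_expansion fps_shift 1 G" by (simp only: q_def[abs_def] power_one_right)
  have il: "inv_log f = (\<lambda>w. Ln (q w))" by (auto simp: inv_log_def q_def)
  have q0: "q 0 = 1" by (simp add: q_def)
  have anq: "q analytic_on {0}" by (rule has_fps_expansion_imp_analytic_0[OF Q])
  define L where "L = fps_expansion (inv_log f) 0"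
  have L: "inv_log f has_fps_expansion L"
    unfolding L_def il using anq
    by (intro analytic_at_imp_has_fps_expansion_0 analytic_on_ln) (use q0 in auto)
  have L0: "fps_nth L 0 = 0"
    using has_fps_expansion_imp_0_eq_fps_nth_0[OF L] by (simp add: inv_log_def)
  have "isCont q 0" using has_fps_expansion_imp_continuous[OF Q, of UNIV] by simp
  \<comment> \<open>\<open>exp\<close> undoes \<open>Ln\<close> only where \<open>q\<close> is
    nonzero; continuity and \<open>q 0 = 1\<close> provide such a neighbourhood.\<close>
  then have "\<forall>\<^sub>F w in nhds 0. q w \<in> - {0}"
    by (intro topological_tendstoD[of q "q 0"]) (auto simp: q_def isCont_def tendsto_nhds_iff)
  then have "\<forall>\<^sub>F w in nhds 0. (exp \<circ> inv_log f) w = q w"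
    by eventually_elim (simp add: il)
  with has_fps_expansion_compose[OF has_fps_expansion_exp1 L L0] Q
  have eq: "fps_exp 1 oo L = fps_shift 1 G"
    by (rule fps_expansion_unique_eventually)
  \<comment> \<open>Division by \<open>w\<close> shifts indices: order n of the exponential series
    corresponds to order n + 1 of \<open>G\<close>.\<close>
  have L1: "fps_nth L 1 = fps_nth G 2"
    using arg_cong[OF eq, of "\<lambda>H. fps_nth H 1"]
    by (simp only: fps_compose_nth_low[OF L0]) (simp add: numeral_2_eq_2)
  have L2: "fps_nth L 2 + (fps_nth L 1)\<^sup>2 / 2 = fps_nth G 3"
    using arg_cong[OF eq, of "\<lambda>H. fps_nth H 2"]
    by (simp only: fps_compose_nth_low[OF L0]) simp
  show "inv_log_coeff f 1 = - fps_nth F 2 / 2"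
    using L1 G(4) by (simp add: inv_log_coeff_def L_def)
  have "fps_nth L 2 = - (fps_nth F 3 - 3 / 2 * (fps_nth F 2)\<^sup>2)"
    using L1 L2 G(4,5) by (simp add: field_simps)
  then show "inv_log_coeff f 2 = - (fps_nth F 3 - 3 / 2 * (fps_nth F 2)\<^sup>2) / 2"
    by (simp add: inv_log_coeff_def L_def)
qed

section \<open>Coefficients of starlike functions\<close>

text \<open>Clearing the denominator gives \<open>F * H = fps_X * fps_deriv F\<close> with
  \<open>H\<close> the series of \<open>\<phi> \<circ> \<omega>\<close>. Orders 2 and 3 determine
  the coefficients of \<open>f\<close>, which are then inserted into the formulas for the
  inverse.\<close>

lemma starlike_inv_log_coeffs:
  assumes A: "f \<in> class_A" and nz: "\<And>z. z \<in> \<U> - {0} \<Longrightarrow> f z \<noteq> 0"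
    and \<phi>: "\<phi> has_fps_expansion \<Phi>" "\<phi> 0 = 1"
    and \<omega>: "\<omega> has_fps_expansion W" "\<omega> 0 = 0"
    and eq: "\<And>z. z \<in> \<U> - {0} \<Longrightarrow> z * deriv f z / f z = \<phi> (\<omega> z)"
  shows "inv_log_coeff f 1 = - fps_nth \<Phi> 1 * fps_nth W 1 / 2"
    and "inv_log_coeff f 2 =
      - (fps_nth \<Phi> 1 * fps_nth W 2 + (fps_nth \<Phi> 2 - 2 * (fps_nth \<Phi> 1)\<^sup>2) * (fps_nth W 1)\<^sup>2) / 4"
proof -
  define F where "F = fps_expansion f 0"
  have F: "f has_fps_expansion F"
    unfolding F_def using A by (intro holomorphic_has_fps_expansion) (simp add: class_A_def)
  have F0: "fps_nth F 0 = 0" and F1: "fps_nth F 1 = 1"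
    using A has_fps_expansion_deriv_0[OF F] has_fps_expansion_imp_0_eq_fps_nth_0[OF F]
    by (auto simp: class_A_def)
  have W0: "fps_nth W 0 = 0" and \<Phi>0: "fps_nth \<Phi> 0 = 1"
    using has_fps_expansion_imp_0_eq_fps_nth_0 \<phi> \<omega> by metis+
  define H where "H = \<Phi> oo W"
  have "(\<phi> \<circ> \<omega>) has_fps_expansion H"
    unfolding H_def by (rule has_fps_expansion_compose[OF \<phi>(1) \<omega>(1) W0])
  then have "(\<lambda>z. f z * (\<phi> \<circ> \<omega>) z) has_fps_expansion F * H"
    by (rule has_fps_expansion_mult[OF F])
  moreover have "(\<lambda>z. z * deriv f z) has_fps_expansion fps_X * fps_deriv F"
    by (intro fps_expansion_intros F)
  \<comment> \<open>The quotient equation excludes 0, but the cleared equation holds there too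
    because \<open>f 0 = 0\<close>.\<close>
  moreover have "\<forall>\<^sub>F z in nhds 0. f z * (\<phi> \<circ> \<omega>) z = z * deriv f z"
  proof (rule eventually_mono[OF eventually_nhds_in_open[of \<U>]])
    fix z :: complex
    assume "z \<in> \<U>"
    then show "f z * (\<phi> \<circ> \<omega>) z = z * deriv f z"
      using nz[of z] eq[of z] A by (cases "z = 0") (auto simp: class_A_def field_simps)
  qed auto
  ultimately have XF: "F * H = fps_X * fps_deriv F"
    by (rule fps_expansion_unique_eventually)
  have H0: "fps_nth H 0 = 1" by (simp add: H_def \<Phi>0)
  \<comment> \<open>Since \<open>H\<close> has constant term 1, the n-th coefficient of
    \<open>F\<close> occurs on both sides, with factors n and 1; the remaining factor n - 1 is
    invertible.\<close>
  have 2: "2 * fps_nth F 2 = fps_nth H 1 + fps_nth F 2"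
    using arg_cong[OF XF, of "\<lambda>K. fps_nth K 2"] F0 F1 H0
    unfolding fps_mult_nth_2[of F] by (simp add: numeral_2_eq_2)
  have 3: "3 * fps_nth F 3 = fps_nth H 2 + fps_nth F 2 * fps_nth H 1 + fps_nth F 3"
    using arg_cong[OF XF, of "\<lambda>K. fps_nth K 3"] F0 F1 H0
    unfolding fps_mult_nth_3[of F] by (simp add: numeral_3_eq_3 numeral_2_eq_2)
  have a2: "fps_nth F 2 = fps_nth \<Phi> 1 * fps_nth W 1"
    using 2 by (simp add: H_def fps_compose_nth_low[OF W0] del: One_nat_def)
  then have a3: "fps_nth F 3 = (fps_nth \<Phi> 1 * fps_nth W 2
      + (fps_nth \<Phi> 2 + (fps_nth \<Phi> 1)\<^sup>2) * (fps_nth W 1)\<^sup>2) / 2"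
    using 3 by (simp add: H_def fps_compose_nth_low[OF W0] field_simps power2_eq_square del: One_nat_def)
  show "inv_log_coeff f 1 = - fps_nth \<Phi> 1 * fps_nth W 1 / 2"
    unfolding inv_log_coeffs(1)[OF A F] a2 by simp
  show "inv_log_coeff f 2 =
      - (fps_nth \<Phi> 1 * fps_nth W 2 + (fps_nth \<Phi> 2 - 2 * (fps_nth \<Phi> 1)\<^sup>2) * (fps_nth W 1)\<^sup>2) / 4"
    unfolding inv_log_coeffs(2)[OF A F] a2 a3 by (simp add: field_simps power2_eq_square)
qed

section \<open>Construction of starlike functions from Schwarz functions\<close>

text \<open>With \<open>p = \<phi> \<circ> \<omega>\<close>, the equation
  \<open>z f'(z) / f(z) = p(z)\<close> is solved by \<open>z\<close> times the exponential of the
  integral of \<open>(p(t) - 1) / t\<close> from 0 to \<open>z\<close>. The exponential has no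
  zeros, so \<open>f\<close> vanishes only at 0.\<close>

lemma starlike_class_function_exists:
  assumes hol: "\<phi> holomorphic_on \<U>" and \<phi>0: "\<phi> 0 = 1"
    and \<omega>: "\<omega> holomorphic_on \<U>" "\<omega> 0 = 0" "\<And>z. z \<in> \<U> \<Longrightarrow> \<omega> z \<in> \<U>"
  obtains f where "f \<in> starlike_class \<phi>" "\<And>z. z \<in> \<U> - {0} \<Longrightarrow> z * deriv f z / f z = \<phi> (\<omega> z)"
proof -
  define p where "p = \<phi> \<circ> \<omega>"
  have holp: "p holomorphic_on \<U>"
    unfolding p_def by (rule holomorphic_on_compose_gen[OF \<omega>(1) hol]) (use \<omega>(3) in auto)
  have p0: "p 0 = 1" by (simp add: p_def \<omega> \<phi>0)
  \<comment> \<open>The value \<open>deriv p 0\<close> removes the singularity of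
    \<open>(p(z) - 1) / z\<close>.\<close>
  define k where "k z = (if z = 0 then deriv p 0 else (p z - p 0) / (z - 0))" for z
  have "k holomorphic_on \<U>"
    unfolding k_def[abs_def] by (rule pole_lemma[OF holp]) auto
  then obtain P where "\<And>z. z \<in> \<U> \<Longrightarrow> (P has_field_derivative k z) (at z within \<U>)"
    using holomorphic_convex_primitive'[of \<U> k] by auto
  then have P: "(P has_field_derivative k z) (at z)" if "z \<in> \<U>" for z
    using that by (metis at_within_open open_ball)
  \<comment> \<open>Subtracting \<open>P 0\<close> normalizes the derivative of \<open>f\<close> at
    0 to 1.\<close>
  define f where "f z = z * exp (P z - P 0)" for z
  have df: "(f has_field_derivative exp (P z - P 0) * p z) (at z)" if "z \<in> \<U>" for z
  proof -
    have "(f has_field_derivative exp (P z - P 0) * (1 + z * k z)) (at z)"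
      unfolding f_def[abs_def] using P[OF that]
      by (auto intro!: derivative_eq_intros simp: algebra_simps)
    moreover have "1 + z * k z = p z" by (simp add: k_def p0)
    ultimately show ?thesis by simp
  qed
  have dfz: "deriv f z = exp (P z - P 0) * p z" if "z \<in> \<U>" for z
    using df[OF that] by (rule DERIV_imp_deriv)
  have "f holomorphic_on \<U>" using df by (fastforce simp: holomorphic_on_open)
  then have A: "f \<in> class_A" using dfz[of 0] p0 by (simp add: class_A_def f_def)
  have quot: "z * deriv f z / f z = \<phi> (\<omega> z)" if "z \<in> \<U> - {0}" for z
    using that dfz[of z] by (simp add: f_def p_def)
  have "(\<lambda>z. if z = 0 then 1 else z * deriv f z / f z) \<prec>\<^sub>s \<phi>"
    unfolding subordinate_def
    using \<omega> \<phi>0 quot by (intro exI[of _ \<omega>]) (auto intro: less_imp_le)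
  then have "f \<in> starlike_class \<phi>"
    using A by (auto simp: starlike_class_def f_def)
  then show ?thesis using quot that by blast
qed

section \<open>The sharp bound and an extremal function\<close>

theorem theorem2:
  fixes \<phi> :: "complex \<Rightarrow> complex" and B :: "nat \<Rightarrow> real"
  defines "B \<equiv> ma_minda_coeff \<phi>"
  assumes "ma_minda \<phi>"
    and "\<bar>B 2 - 2 * (B 1)\<^sup>2\<bar> \<ge> B 1"
  shows "(\<forall>f\<in>starlike_class \<phi>.
            cmod (T21_inv_log f) \<le> (B 1)\<^sup>2 / 4 + (2 * (B 1)\<^sup>2 - B 2)\<^sup>2 / 16) \<and>
         (\<exists>f\<in>starlike_class \<phi>.
            cmod (T21_inv_log f) = (B 1)\<^sup>2 / 4 + (2 * (B 1)\<^sup>2 - B 2)\<^sup>2 / 16)"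
proof
  have hol: "\<phi> holomorphic_on \<U>" and \<phi>0: "\<phi> 0 = 1" and pos: "Re (deriv \<phi> 0) > 0"
    using assms(2) by (auto simp: ma_minda_def)
  define \<Phi> where "\<Phi> = fps_expansion \<phi> 0"
  have \<Phi>: "\<phi> has_fps_expansion \<Phi>" unfolding \<Phi>_def using hol by (rule holomorphic_has_fps_expansion)
  have \<Phi>B: "fps_nth \<Phi> n = complex_of_real (B n)" for n
    unfolding \<Phi>_def B_def by (rule ma_minda_coeff_real[OF assms(2)])
  have B1: "B 1 > 0" using pos has_fps_expansion_deriv_0[OF \<Phi>] \<Phi>B[of 1] by simp
  define D where "D = B 2 - 2 * (B 1)\<^sup>2"
  have D: "(2 * (B 1)\<^sup>2 - B 2)\<^sup>2 = D\<^sup>2" by (simp add: D_def power2_commute)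
  have BD: "B 1 \<le> \<bar>D\<bar>" using assms(3) by (simp add: D_def)
  \<comment> \<open>Stated for an arbitrary \<omega> realizing the subordination, so that it serves
    both the upper bound and the extremal function.\<close>
  have \<Gamma>: "inv_log_coeff f 1 = - complex_of_real (B 1) * fps_nth W 1 / 2"
      "inv_log_coeff f 2 = - (complex_of_real (B 1) * fps_nth W 2 + complex_of_real D * (fps_nth W 1)\<^sup>2) / 4"
    if f: "f \<in> starlike_class \<phi>" and \<omega>: "\<omega> has_fps_expansion W" "\<omega> 0 = 0"
      and eq: "\<And>z. z \<in> \<U> - {0} \<Longrightarrow> z * deriv f z / f z = \<phi> (\<omega> z)" for f \<omega> W
  proof -
    have "f \<in> class_A" "\<And>z. z \<in> \<U> - {0} \<Longrightarrow> f z \<noteq> 0" using f by (auto simp: starlike_class_def)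
    note * = starlike_inv_log_coeffs[OF this \<Phi> \<phi>0 \<omega> eq, unfolded \<Phi>B]
    show "inv_log_coeff f 1 = - complex_of_real (B 1) * fps_nth W 1 / 2" using *(1) .
    show "inv_log_coeff f 2 = - (complex_of_real (B 1) * fps_nth W 2 + complex_of_real D * (fps_nth W 1)\<^sup>2) / 4"
      using *(2) by (simp add: D_def)
  qed
  show "\<forall>f\<in>starlike_class \<phi>. cmod (T21_inv_log f) \<le> (B 1)\<^sup>2 / 4 + (2 * (B 1)\<^sup>2 - B 2)\<^sup>2 / 16"
  proof
    fix f assume f: "f \<in> starlike_class \<phi>"
    then obtain \<omega> where \<omega>: "\<omega> holomorphic_on \<U>" "\<omega> 0 = 0" "\<And>z. z \<in> \<U> \<Longrightarrow> cmod (\<omega> z) \<le> 1"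
      and eq: "\<And>z. z \<in> \<U> \<Longrightarrow> (if z = 0 then 1 else z * deriv f z / f z) = \<phi> (\<omega> z)"
      unfolding starlike_class_def subordinate_def by blast
    have eq': "z * deriv f z / f z = \<phi> (\<omega> z)" if "z \<in> \<U> - {0}" for z
      using eq[of z] that by simp
    define W where "W = fps_expansion \<omega> 0"
    have W: "\<omega> has_fps_expansion W" unfolding W_def using \<omega>(1) by (rule holomorphic_has_fps_expansion)
    define x y where "x = cmod (fps_nth W 1)" and "y = cmod (fps_nth W 2)"
    have xy: "y \<le> 1 - x\<^sup>2" unfolding x_def y_def by (rule Schwarz_function_coeffs[OF \<omega> W])
    have y0: "0 \<le> y" by (simp add: y_def)
    then have x1: "x\<^sup>2 \<le> 1" using xy by simp
    have "cmod (inv_log_coeff f 1) = B 1 * x / 2"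
      using B1 \<Gamma>(1)[OF f W \<omega>(2) eq'] by (simp add: norm_mult x_def)
    then have \<Gamma>1: "(cmod (inv_log_coeff f 1))\<^sup>2 \<le> (B 1)\<^sup>2 / 4"
      using mult_left_mono[OF x1, of "(B 1)\<^sup>2"]
      by (simp only: power_mult_distrib power_divide) simp
    have "4 * cmod (inv_log_coeff f 2)
        = cmod (complex_of_real (B 1) * fps_nth W 2 + complex_of_real D * (fps_nth W 1)\<^sup>2)"
      by (simp only: \<Gamma>(2)[OF f W \<omega>(2) eq'] norm_divide norm_minus_cancel) simp
    also have "\<dots> \<le> B 1 * y + \<bar>D\<bar> * x\<^sup>2"
      by (rule order_trans[OF norm_triangle_ineq]) (use B1 in \<open>simp add: norm_mult norm_power x_def y_def\<close>)
    \<comment> \<open>The assumption \<open>B 1 \<le> \<bar>D\<bar>\<close> enters here: after this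
      replacement the dependence on \<open>x\<close> cancels.\<close>
    also have "\<dots> \<le> \<bar>D\<bar> * (1 - x\<^sup>2) + \<bar>D\<bar> * x\<^sup>2"
      using mult_mono[OF BD xy] y0 by simp
    also have "\<dots> = \<bar>D\<bar>" by (simp add: algebra_simps)
    finally have "(4 * cmod (inv_log_coeff f 2))\<^sup>2 \<le> \<bar>D\<bar>\<^sup>2" by (intro power_mono) auto
    then have \<Gamma>2: "(cmod (inv_log_coeff f 2))\<^sup>2 \<le> D\<^sup>2 / 16" by (simp add: power_mult_distrib)
    \<comment> \<open>The triangle inequality loses nothing exactly when the first square and the
      negated second square have the same direction, which guides the choice of the extremal
      function.\<close>
    have "cmod (T21_inv_log f) \<le> (cmod (inv_log_coeff f 1))\<^sup>2 + (cmod (inv_log_coeff f 2))\<^sup>2"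
      unfolding T21_inv_log_def by (metis norm_power norm_triangle_ineq4)
    then show "cmod (T21_inv_log f) \<le> (B 1)\<^sup>2 / 4 + (2 * (B 1)\<^sup>2 - B 2)\<^sup>2 / 16"
      unfolding D using \<Gamma>1 \<Gamma>2 by linarith
  qed
  define \<omega> :: "complex \<Rightarrow> complex" where "\<omega> z = \<i> * z" for z
  obtain f where f: "f \<in> starlike_class \<phi>"
    and eq: "\<And>z. z \<in> \<U> - {0} \<Longrightarrow> z * deriv f z / f z = \<phi> (\<omega> z)"
    by (rule starlike_class_function_exists[OF hol \<phi>0, of \<omega>])
       (auto simp: \<omega>_def[abs_def] norm_mult intro!: holomorphic_intros)
  have W: "\<omega> has_fps_expansion fps_const \<i> * fps_X"
    unfolding \<omega>_def[abs_def] by (intro fps_expansion_intros)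
  \<comment> \<open>Here \<open>w\<^sub>1 = \<i>\<close> and \<open>w\<^sub>2 = 0\<close>, so
    \<open>w\<^sub>1^2 = -1\<close> absorbs the minus sign in the second coefficient.\<close>
  have "inv_log_coeff f 1 = - complex_of_real (B 1) * \<i> / 2"
    and "inv_log_coeff f 2 = complex_of_real D / 4"
    using \<Gamma>[OF f W _ eq] by (simp_all add: \<omega>_def)
  then have "T21_inv_log f = - complex_of_real ((B 1)\<^sup>2 / 4 + D\<^sup>2 / 16)"
    by (simp only: T21_inv_log_def power_mult_distrib power_divide) (simp add: power_mult_distrib)
  then have "cmod (T21_inv_log f) = (B 1)\<^sup>2 / 4 + D\<^sup>2 / 16"
    by (simp only: norm_minus_cancel norm_of_real) simp
  then show "\<exists>f\<in>starlike_class \<phi>. cmod (T21_inv_log f) = (B 1)\<^sup>2 / 4 + (2 * (B 1)\<^sup>2 - B 2)\<^sup>2 / 16"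
    unfolding D using f by blast
qed

end
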